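(* For every integer $d\ge 2$ and every $n\ge d$ there exists an ACS $(n,d)$-polytope.
   Context: An ACS (alternating centrally symmetric) $(n,d)$-polytope is a convex polytope $P\subset\mathbb{R}^d$ with $2n$ centrally symmetric vertices $p_1,-p_1,\ldots,p_n,-p_n$ such that the simplices spanned by vertices of $P$ that contain the origin in their (relative) interior are exactly the edges $[p_i,-p_i]$ ($1\le i\le n$) and the $d$-simplices with vertex sets $\{p_{k_0},-p_{k_1},p_{k_2},\ldots,(-1)^dp_{k_d}\}$ and $\{-p_{k_0},p_{k_1},\ldots,(-1)^{d+1}p_{k_d}\}$ for $1\le k_0<k_1<\cdots<k_d\le n$. *)

theory Defs
  imports "HOL-Analysis.Analysis"
begin

text \<open>Simplices are represented by their vertex sets: affinely independent sets of points.\<close>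

definition origin_simplices :: "(real^'d) set \<Rightarrow> (real^'d) set set" where
  "origin_simplices V =
     {S. S \<subseteq> V \<and> \<not> affine_dependent S \<and> 0 \<in> rel_interior (convex hull S)}"

text \<open>For \<open>\<epsilon> = 1\<close> this is \<open>{p (k 0), - p (k 1), p (k 2), \<dots>}\<close>, ending with index
  \<open>d = CARD('d)\<close>; for \<open>\<epsilon> = - 1\<close> it is its antipode.\<close>

definition alternating_vertices ::
    "(nat \<Rightarrow> real^'d) \<Rightarrow> real \<Rightarrow> (nat \<Rightarrow> nat) \<Rightarrow> (real^'d) set" where
  "alternating_vertices p \<epsilon> k = (\<lambda>j. (\<epsilon> * (- 1) ^ j) *\<^sub>R p (k j)) ` {0..CARD('d)}"

text \<open>The ambient dimension \<open>d\<close> is \<open>CARD('d)\<close>. The cardinality condition says that the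
  \<open>2 * n\<close> points \<open>p i\<close> and \<open>- p i\<close> are pairwise distinct.\<close>

definition ACS_polytope :: "nat \<Rightarrow> (real^'d) set \<Rightarrow> bool" where
  "ACS_polytope n P \<longleftrightarrow>
     polytope P \<and>
     (\<exists>p :: nat \<Rightarrow> real^'d.
        {v. v extreme_point_of P} = p ` {1..n} \<union> (\<lambda>i. - p i) ` {1..n} \<and>
        card {v. v extreme_point_of P} = 2 * n \<and>
        origin_simplices {v. v extreme_point_of P} =
          {{p i, - p i} | i. i \<in> {1..n}} \<union>
          {alternating_vertices p \<epsilon> k | \<epsilon> k.
             \<epsilon> \<in> {1, - 1} \<and> strict_mono_on {0..CARD('d)} k \<and> k ` {0..CARD('d)} \<subseteq> {1..n}})"

end

theory Submission
  imports Defs "HOL-Computational_Algebra.Polynomial" "HOL-Library.Infinite_Set"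
begin

text \<open>Take the \<open>p i\<close> to be points of the moment curve, rescaled to unit length. All points
  \<open>p i\<close>, \<open>- p i\<close> lie on the sphere, so each of them is a vertex of their convex hull. Positive
  rescaling does not affect the signs in a linear dependence, and the \<open>d + 1\<close> coefficients of a
  dependence between points of the moment curve alternate in sign: pair the dependence with a polynomial
  of degree \<open>d - 1\<close> that vanishes at all but two consecutive parameters. Since \<open>0\<close> lies in the
  relative interior of a simplex iff it is a strictly positive combination of its vertices, this
  sign pattern determines all simplices in question.\<close>

section \<open>Signs of dependences on the moment curve\<close>

lemma sum_mult_poly_eq_0:
  fixes a t :: "'i \<Rightarrow> 'a::comm_ring_1"
  assumes "\<And>m. m < d \<Longrightarrow> (\<Sum>i\<in>I. a i * t i ^ m) = 0" and "degree q < d"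
  shows "(\<Sum>i\<in>I. a i * poly q (t i)) = 0"
proof -
  have "(\<Sum>i\<in>I. a i * poly q (t i)) = (\<Sum>i\<in>I. \<Sum>m\<le>degree q. coeff q m * (a i * t i ^ m))"
    by (simp add: poly_altdef sum_distrib_left mult_ac)
  also have "\<dots> = (\<Sum>m\<le>degree q. coeff q m * (\<Sum>i\<in>I. a i * t i ^ m))"
    by (subst sum.swap) (simp add: sum_distrib_left)
  also have "\<dots> = 0"
    using assms by (intro sum.neutral) auto
  finally show ?thesis .
qed

text \<open>Testing against a polynomial with roots at all parameters except \<open>t j\<close> and
  \<open>t (Suc j)\<close> leaves a two-term relation. No root separates these two parameters, so
  the polynomial has the same sign at both and the coefficients have opposite signs. Phrasing this
  with \<open>sgn\<close> also covers zeros: if one coefficient vanishes, all do.\<close>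

lemma sgn_alternating_of_moments_eq_0:
  fixes a t :: "nat \<Rightarrow> real"
  assumes t: "strict_mono_on {0..d} t"
    and moments: "\<And>m. m < d \<Longrightarrow> (\<Sum>i=0..d. a i * t i ^ m) = 0"
    and "j \<le> d"
  shows "sgn (a j) = (- 1) ^ j * sgn (a 0)"
  using \<open>j \<le> d\<close>
proof (induction j)
  case 0
  then show ?case by simp
next
  case (Suc j)
  define R where "R = {0..d} - {j, Suc j}"
  define q where "q = (\<Prod>i\<in>R. [:- t i, 1:])"
  \<comment> \<open>Two of the d + 1 indices are left out, so the degree is d - 1, the largest that
    the vanishing moments allow.\<close>
  have "degree q = card R"
    by (simp add: q_def degree_prod_sum_eq)
  also have "card R < d"
    using Suc.prems by (simp add: R_def card_Diff_subset)
  finally have "(\<Sum>i=0..d. a i * poly q (t i)) = 0"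
    by (intro sum_mult_poly_eq_0 moments)
  moreover have "(\<Sum>i=0..d. a i * poly q (t i)) = (\<Sum>i\<in>{j, Suc j}. a i * poly q (t i))"
    using Suc.prems by (intro sum.mono_neutral_right) (auto simp: q_def poly_prod R_def)
  ultimately have rel: "a j * poly q (t j) + a (Suc j) * poly q (t (Suc j)) = 0"
    by simp
  \<comment> \<open>This is where consecutive indices matter: every \<open>i\<close> in
    \<open>R\<close> lies below \<open>j\<close> or above \<open>Suc j\<close>, so its two factors
    agree in sign.\<close>
  have "0 < (t j - t i) * (t (Suc j) - t i)" if "i \<in> R" for i
  proof (cases "i < j")
    case True
    then show ?thesis
      using Suc.prems t that by (intro mult_pos_pos) (auto simp: strict_mono_on_def)
  next
    case False
    then have "Suc j < i" using that by (auto simp: R_def)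
    then show ?thesis
      using Suc.prems t that by (intro mult_neg_neg) (auto simp: strict_mono_on_def R_def)
  qed
  then have pos: "0 < poly q (t j) * poly q (t (Suc j))"
    by (auto simp: q_def poly_prod simp flip: prod.distrib intro!: prod_pos)
  have "sgn (a (Suc j)) = - sgn (a j)"
  proof -
    have "a (Suc j) * poly q (t (Suc j)) = - (a j * poly q (t j))"
      using rel by linarith
    then have "sgn (a (Suc j)) * sgn (poly q (t (Suc j))) = - (sgn (a j) * sgn (poly q (t j)))"
      by (metis sgn_minus sgn_mult)
    moreover have "sgn (poly q (t j)) = sgn (poly q (t (Suc j)))" "poly q (t j) \<noteq> 0"
      using pos by (auto simp: zero_less_mult_iff)
    ultimately show ?thesis
      by (metis minus_mult_left mult_right_cancel sgn_0_0)
  qed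
  with Suc show ?case by simp
qed

section \<open>Vector families with alternating dependences\<close>

text \<open>Such a family realizes the alternating oriented matroid of rank d. The indices range
  over all naturals, which leaves spare ones for padding smaller sets. The trivial dependence is
  included, since \<open>sgn 0 = 0\<close>.\<close>

definition alternating_dependences :: "(nat \<Rightarrow> real^'d) \<Rightarrow> bool" where
  "alternating_dependences p \<longleftrightarrow>
     (\<forall>k b. strict_mono_on {0..CARD('d)} k \<longrightarrow> (\<Sum>j=0..CARD('d). b j *\<^sub>R p (k j)) = 0 \<longrightarrow>
        (\<forall>j\<le>CARD('d). sgn (b j) = (- 1) ^ j * sgn (b 0)))"

lemma alternating_dependencesD:
  fixes p :: "nat \<Rightarrow> real^'d"
  assumes "alternating_dependences p" "strict_mono_on {0..CARD('d)} k"
    and "(\<Sum>j=0..CARD('d). b j *\<^sub>R p (k j)) = 0" "j \<le> CARD('d)"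
  shows "sgn (b j) = (- 1) ^ j * sgn (b 0)"
  using assms unfolding alternating_dependences_def by blast

text \<open>The curve is (1, t, ..., t^(d-1)), where \<open>e\<close> assigns the exponents to the
  coordinates. Read coordinatewise, a dependence of its points says that the moments of order below
  d vanish.\<close>

lemma exists_unit_alternating_dependences:
  "\<exists>p :: nat \<Rightarrow> real^'d::finite. alternating_dependences p \<and> (\<forall>i. norm (p i) = 1)"
proof -
  obtain e where e: "bij_betw e (UNIV :: 'd set) {0..<CARD('d)}"
    using ex_bij_betw_finite_nat[of "UNIV :: 'd set"] by auto
  define v :: "nat \<Rightarrow> real^'d" where "v i = (\<chi> m. real i ^ e m)" for i
  \<comment> \<open>The coordinate with exponent 0 is constantly 1, even at parameter 0 because
    \<open>0 ^ 0 = 1\<close>. Hence every \<open>v i\<close> can be normalized.\<close>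
  obtain m0 where m0: "e m0 = 0"
    using e zero_less_card_finite[where 'a='d] by (metis atLeastLessThan_iff bij_betw_iff_bijections le0)
  have v0: "v i \<noteq> 0" for i
  proof
    assume "v i = 0"
    then have "v i $ m0 = 0" by simp
    then show False by (simp add: v_def m0)
  qed
  define p where "p i = v i /\<^sub>R norm (v i)" for i
  have "sgn (b j) = (- 1) ^ j * sgn (b 0)"
    if k: "strict_mono_on {0..CARD('d)} k" and b: "(\<Sum>j=0..CARD('d). b j *\<^sub>R p (k j)) = 0"
      and j: "j \<le> CARD('d)" for k b j
  proof -
    \<comment> \<open>The normalizing factors move into the coefficients: \<open>a\<close> is a
      dependence of the unscaled points with the signs of \<open>b\<close>.\<close>
    define a where "a j = b j / norm (v (k j))" for j
    have sgn_a: "sgn (a j) = sgn (b j)" for j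
      using v0 by (simp add: a_def sgn_divide)
    have "(\<Sum>j=0..CARD('d). a j * real (k j) ^ m) = 0" if m: "m < CARD('d)" for m
    proof -
      obtain l where l: "e l = m"
        using e m by (metis atLeast0LessThan bij_betw_iff_bijections lessThan_iff)
      have "(\<Sum>j=0..CARD('d). b j *\<^sub>R p (k j)) $ l = 0"
        using b by simp
      then show ?thesis
        by (simp add: p_def v_def l a_def divide_inverse mult_ac)
    qed
    moreover have "strict_mono_on {0..CARD('d)} (\<lambda>j. real (k j))"
      using k by (simp add: strict_mono_on_def)
    ultimately have "sgn (a j) = (- 1) ^ j * sgn (a 0)"
      using sgn_alternating_of_moments_eq_0[of "CARD('d)" "\<lambda>j. real (k j)"] j by blast
    then show ?thesis by (simp add: sgn_a)
  qed
  then have "alternating_dependences p"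
    unfolding alternating_dependences_def by blast
  moreover have "norm (p i) = 1" for i
    using v0 by (simp add: p_def)
  ultimately show ?thesis by blast
qed

lemma obtain_strict_mono_enumeration:
  fixes J :: "nat set"
  assumes "finite J" "card J = Suc d"
  obtains h where "strict_mono_on {0..d} h" "bij_betw h {0..d} J"
proof -
  have "{..<card J} = {0..d}" using assms by auto
  then show thesis
    using ex_bij_betw_strict_mono_card[OF assms(1)] that by metis
qed

text \<open>Pad \<open>I\<close> with fresh indices to d + 1 elements and extend \<open>b\<close> by
  zero. The extended dependence alternates in sign but has a zero coefficient, so all its
  coefficients vanish.\<close>

lemma alternating_dependences_independent:
  fixes p :: "nat \<Rightarrow> real^'d"
  assumes p: "alternating_dependences p"
    and I: "finite I" "card I \<le> CARD('d)"
    and b: "(\<Sum>i\<in>I. b i *\<^sub>R p i) = 0"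
    and i: "i \<in> I"
  shows "b i = 0"
proof -
  obtain J where J: "finite J" "card J = Suc (CARD('d)) - card I" "I \<inter> J = {}"
    using finite_arbitrarily_large_disj[OF infinite_UNIV_nat I(1)] by blast
  have "card (I \<union> J) = Suc (CARD('d))"
    using I J by (simp add: card_Un_disjoint)
  then obtain h where h: "strict_mono_on {0..CARD('d)} h" "bij_betw h {0..CARD('d)} (I \<union> J)"
    using obtain_strict_mono_enumeration I J by (metis finite_UnI)
  define c where "c i = (if i \<in> I then b i else 0)" for i
  have "(\<Sum>j=0..CARD('d). c (h j) *\<^sub>R p (h j)) = (\<Sum>i\<in>I \<union> J. c i *\<^sub>R p i)"
    by (rule sum.reindex_bij_betw[OF h(2)])
  also have "\<dots> = (\<Sum>i\<in>I. b i *\<^sub>R p i)"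
    using I J by (intro sum.mono_neutral_cong_right) (auto simp: c_def)
  also note b
  finally have sgn_c: "sgn (c (h j)) = (- 1) ^ j * sgn (c (h 0))" if "j \<le> CARD('d)" for j
    using alternating_dependencesD[OF p h(1), of "\<lambda>j. c (h j)"] that by blast
  \<comment> \<open>At most d indices were given, so at least one padding index exists.\<close>
  have "J \<noteq> {}" using I J by auto
  then obtain x where "x \<in> J" by blast
  then obtain j where j: "j \<le> CARD('d)" "h j \<in> J"
    using h(2) by (metis UnCI atLeastAtMost_iff bij_betw_iff_bijections)
  then have "c (h j) = 0" using J by (auto simp: c_def)
  then have "c (h 0) = 0" using sgn_c[OF j(1)] by (simp add: sgn_0_0)
  moreover obtain l where "l \<le> CARD('d)" "h l = i"
    using h(2) i by (metis UnCI atLeastAtMost_iff bij_betw_iff_bijections)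
  ultimately have "c i = 0" using sgn_c[of l] by (simp add: sgn_0_0)
  then show ?thesis using i by (simp add: c_def)
qed

text \<open>Independence of pairs, which is where the dimension bound 2 enters. With scalars of
  absolute value 1 it keeps all signed points of different indices apart.\<close>

lemma alternating_dependences_distinct:
  fixes p :: "nat \<Rightarrow> real^'d"
  assumes p: "alternating_dependences p" and "CARD('d) \<ge> 2" "i \<noteq> j" "s \<noteq> 0"
  shows "s *\<^sub>R p i \<noteq> r *\<^sub>R p j"
proof
  assume "s *\<^sub>R p i = r *\<^sub>R p j"
  then have "(\<Sum>l\<in>{i, j}. (if l = i then s else - r) *\<^sub>R p l) = 0"
    using assms by simp
  from alternating_dependences_independent[OF p _ _ this, of i] assms show False
    by simp
qed

section \<open>Convexity criteria and antipodal pairs\<close>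

text \<open>Attaching coefficients to indices instead of points allows signed copies of the
  \<open>p i\<close> to be compared with dependences of the \<open>p i\<close> themselves.\<close>

lemma affine_dependent_image_iff:
  assumes "finite I" "inj_on e I"
  shows "affine_dependent (e ` I) \<longleftrightarrow>
    (\<exists>w. sum w I = 0 \<and> (\<exists>i\<in>I. w i \<noteq> 0) \<and> (\<Sum>i\<in>I. w i *\<^sub>R e i) = 0)" (is "_ \<longleftrightarrow> ?rhs")
proof
  assume "affine_dependent (e ` I)"
  then obtain U where "sum U (e ` I) = 0" "\<exists>v\<in>e ` I. U v \<noteq> 0" "(\<Sum>v\<in>e ` I. U v *\<^sub>R v) = 0"
    using affine_dependent_explicit_finite[of "e ` I"] assms by auto
  then show ?rhs
    using assms by (intro exI[of _ "U \<circ> e"]) (auto simp: sum.reindex)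
next
  assume ?rhs
  then obtain w where "sum w I = 0" "\<exists>i\<in>I. w i \<noteq> 0" "(\<Sum>i\<in>I. w i *\<^sub>R e i) = 0"
    by blast
  then show "affine_dependent (e ` I)"
    using assms
    by (subst affine_dependent_explicit_finite)
      (auto simp: sum.reindex intro!: exI[of _ "w \<circ> inv_into I e"])
qed

lemma zero_in_rel_interior_convex_hull_image_iff:
  fixes e :: "'i \<Rightarrow> 'a::euclidean_space"
  assumes "\<not> affine_dependent (e ` I)" "inj_on e I"
  shows "0 \<in> rel_interior (convex hull (e ` I)) \<longleftrightarrow>
    (\<exists>u. (\<forall>i\<in>I. 0 < u i) \<and> sum u I = 1 \<and> (\<Sum>i\<in>I. u i *\<^sub>R e i) = 0)" (is "_ \<longleftrightarrow> ?rhs")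
proof
  assume "0 \<in> rel_interior (convex hull (e ` I))"
  then obtain U where "\<forall>v\<in>e ` I. 0 < U v" "sum U (e ` I) = 1" "(\<Sum>v\<in>e ` I. U v *\<^sub>R v) = 0"
    unfolding rel_interior_convex_hull_explicit[OF assms(1)] by blast
  then show ?rhs
    using assms by (intro exI[of _ "U \<circ> e"]) (auto simp: sum.reindex)
next
  assume ?rhs
  then obtain u where "\<forall>i\<in>I. 0 < u i" "sum u I = 1" "(\<Sum>i\<in>I. u i *\<^sub>R e i) = 0"
    by blast
  then show "0 \<in> rel_interior (convex hull (e ` I))"
    unfolding rel_interior_convex_hull_explicit[OF assms(1)] using assms(2)
    by (auto simp: sum.reindex intro!: exI[of _ "u \<circ> inv_into I e"])
qed

text \<open>The unit ball is strictly convex: a point inside a segment of the ball is strictly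
  closer to the origin than one of the endpoints, so it cannot have norm 1.\<close>

lemma extreme_points_convex_hull_unit_vectors:
  fixes V :: "'a::euclidean_space set"
  assumes "\<And>v. v \<in> V \<Longrightarrow> norm v = 1"
  shows "{v. v extreme_point_of convex hull V} = V"
proof
  show "{v. v extreme_point_of convex hull V} \<subseteq> V"
    using extreme_point_of_convex_hull by blast
next
  have ball: "convex hull V \<subseteq> cball 0 1"
    using assms by (intro hull_minimal) auto
  show "V \<subseteq> {v. v extreme_point_of convex hull V}"
  proof
    fix v assume v: "v \<in> V"
    have "v \<notin> open_segment a b" if "a \<in> convex hull V" "b \<in> convex hull V" for a b
      using dist_decreases_open_segment[of v a b 0] assms[OF v] subsetD[OF ball that(1)]
        subsetD[OF ball that(2)] by auto
    then show "v \<in> {v. v extreme_point_of convex hull V}"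
      using v by (simp add: extreme_point_of_def hull_inc)
  qed
qed

lemma neq_minus_self:
  fixes x :: "'a::real_vector"
  assumes "x \<noteq> 0"
  shows "x \<noteq> - x"
proof
  assume "x = - x"
  then have "2 *\<^sub>R x = 0"
    by (simp only: scaleR_2 eq_neg_iff_add_eq_0)
  with assms show False by simp
qed

lemma zero_in_rel_interior_convex_hull_antipodal:
  fixes x :: "'a::euclidean_space"
  assumes "x \<noteq> 0"
  shows "0 \<in> rel_interior (convex hull {x, - x})"
proof -
  have neq: "x \<noteq> - x"
    using neq_minus_self assms .
  have "midpoint x (- x) \<in> open_segment x (- x)"
    using neq midpoint_in_open_segment by blast
  moreover have "midpoint x (- x) = 0"
    by (simp add: midpoint_def)
  ultimately show ?thesis
    using neq by (simp add: rel_interior_closed_segment flip: segment_convex_hull)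
qed

text \<open>Barycentric coordinates in a simplex are unique. The origin is the midpoint of
  \<open>x\<close> and \<open>- x\<close>, so a further vertex would have coordinate 0, whereas
  relative interior points have only positive coordinates.\<close>

lemma antipodal_simplex_eq:
  fixes S :: "'a::euclidean_space set"
  assumes S: "\<not> affine_dependent S" "0 \<in> rel_interior (convex hull S)"
    and x: "x \<in> S" "- x \<in> S" "x \<noteq> 0"
  shows "S = {x, - x}"
proof (rule ccontr)
  assume "S \<noteq> {x, - x}"
  then obtain y where y: "y \<in> S" "y \<noteq> x" "y \<noteq> - x"
    using x by blast
  have fin: "finite S" using S aff_independent_finite by blast
  obtain u where u: "\<forall>z\<in>S. 0 < u z" "sum u S = 1" "(\<Sum>z\<in>S. u z *\<^sub>R z) = 0"
    using S unfolding rel_interior_convex_hull_explicit[OF S(1)] by blast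
  have neq: "x \<noteq> - x" using neq_minus_self x(3) .
  define h :: "'a \<Rightarrow> real" where "h z = (if z \<in> {x, - x} then 1 / 2 else 0)" for z
  have "sum h S = sum h {x, - x}"
    using fin x by (intro sum.mono_neutral_right) (auto simp: h_def)
  then have h1: "sum h S = 1" using neq by (simp add: h_def)
  have "(\<Sum>z\<in>S. h z *\<^sub>R z) = (\<Sum>z\<in>{x, - x}. h z *\<^sub>R z)"
    using fin x by (intro sum.mono_neutral_right) (auto simp: h_def)
  then have h2: "(\<Sum>z\<in>S. h z *\<^sub>R z) = 0" using neq by (simp add: h_def)
  \<comment> \<open>The two representations of the origin differ at \<open>y\<close>, so their
    difference is a nontrivial affine dependence.\<close>
  have "u y - h y \<noteq> 0"
    using u y by (auto simp: h_def)
  then have "affine_dependent S"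
    unfolding affine_dependent_explicit_finite[OF fin] using u y h1 h2
    by (intro exI[of _ "\<lambda>z. u z - h z"]) (auto simp: sum_subtractf scaleR_diff_left)
  with S show False by blast
qed

section \<open>The alternating simplices contain the origin\<close>

lemma exists_nontrivial_dependence:
  fixes x :: "nat \<Rightarrow> real^'d"
  assumes "inj_on x {0..CARD('d)}"
  obtains b where "(\<Sum>j=0..CARD('d). b j *\<^sub>R x j) = 0" "\<exists>j\<le>CARD('d). b j \<noteq> 0"
proof -
  have "dependent (x ` {0..CARD('d)})"
    using assms by (intro dependent_biggerset) (simp add: card_image)
  then obtain U where "\<exists>v\<in>x ` {0..CARD('d)}. U v \<noteq> 0" "(\<Sum>v\<in>x ` {0..CARD('d)}. U v *\<^sub>R v) = 0"
    using dependent_finite[of "x ` {0..CARD('d)}"] by auto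
  then show thesis
    using assms by (intro that[of "U \<circ> x"]) (auto simp: sum.reindex)
qed

text \<open>The signs of the vertices cancel the alternation of dependences, so every linear
  dependence of the vertices has coefficients of a single sign. Coefficients summing to 0 must then
  vanish, which gives affine independence. A nontrivial dependence exists by dimension, and
  normalizing it gives the positive weights for the origin.\<close>

lemma alternating_vertices_origin_simplex:
  fixes p :: "nat \<Rightarrow> real^'d"
  assumes p: "alternating_dependences p" and d: "CARD('d) \<ge> 2"
    and k: "strict_mono_on {0..CARD('d)} k" and \<epsilon>: "\<epsilon> \<in> {1, - 1}"
  shows "\<not> affine_dependent (alternating_vertices p \<epsilon> k)"
    and "0 \<in> rel_interior (convex hull (alternating_vertices p \<epsilon> k))"
proof -
  let ?D = "{0..CARD('d)}"
  define e where "e j = (\<epsilon> * (- 1) ^ j) *\<^sub>R p (k j)" for j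
  have S: "alternating_vertices p \<epsilon> k = e ` ?D"
    by (simp add: alternating_vertices_def e_def)
  have k_inj: "inj_on k ?D"
    using k by (rule strict_mono_on_imp_inj_on)
  have nz: "\<epsilon> * (- 1) ^ j \<noteq> 0" for j
    using \<epsilon> by auto
  have inj: "inj_on e ?D"
  proof (rule inj_onI)
    fix i j assume ij: "i \<in> ?D" "j \<in> ?D" "e i = e j"
    then have "k i = k j"
      using alternating_dependences_distinct[OF p d _ nz] unfolding e_def by blast
    with ij k_inj show "i = j" by (blast dest: inj_onD)
  qed
  have p_inj: "inj_on (\<lambda>j. p (k j)) ?D"
  proof (rule inj_onI)
    fix i j assume ij: "i \<in> ?D" "j \<in> ?D" "p (k i) = p (k j)"
    then have "k i = k j"
      using alternating_dependences_distinct[OF p d, of "k i" "k j" 1 1] by auto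
    with ij k_inj show "i = j" by (blast dest: inj_onD)
  qed
  have sgn_\<epsilon>: "sgn \<epsilon> = \<epsilon>" "\<epsilon> * \<epsilon> = 1" "\<epsilon> \<noteq> 0"
    using \<epsilon> by auto
  show indep: "\<not> affine_dependent (alternating_vertices p \<epsilon> k)"
  proof
    assume "affine_dependent (alternating_vertices p \<epsilon> k)"
    then obtain w where w: "sum w ?D = 0" "\<exists>j\<in>?D. w j \<noteq> 0" "(\<Sum>j\<in>?D. w j *\<^sub>R e j) = 0"
      unfolding S using affine_dependent_image_iff[OF _ inj] by auto
    have "sgn (w j) = sgn (w 0)" if "j \<le> CARD('d)" for j
    proof -
      have "sgn (w j * (\<epsilon> * (- 1) ^ j)) = (- 1) ^ j * sgn (w 0 * (\<epsilon> * (- 1) ^ 0))"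
        using alternating_dependencesD[OF p k, of "\<lambda>j. w j * (\<epsilon> * (- 1) ^ j)"] w(3) that
        by (simp add: e_def)
      then show ?thesis
        using sgn_\<epsilon> by (cases "even j") (simp_all add: sgn_mult)
    qed
    then consider "\<forall>j\<in>?D. 0 < w j" | "\<forall>j\<in>?D. w j < 0" | "\<forall>j\<in>?D. w j = 0"
      by (metis atLeastAtMost_iff linorder_neqE_linordered_idom sgn_0_0 sgn_1_neg sgn_1_pos)
    then show False
    proof cases
      case 1
      then have "0 < sum w ?D" by (intro sum_pos) auto
      with w show ?thesis by simp
    next
      case 2
      then have "0 < (\<Sum>j\<in>?D. - w j)" by (intro sum_pos) auto
      with w show ?thesis by (simp add: sum_negf)
    next
      case 3
      with w show ?thesis by blast
    qed
  qed
  obtain b where b: "(\<Sum>j\<in>?D. b j *\<^sub>R p (k j)) = 0" "\<exists>j\<le>CARD('d). b j \<noteq> 0"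
    using exists_nontrivial_dependence[OF p_inj] by blast
  have sgn_b: "sgn (b j) = (- 1) ^ j * sgn (b 0)" if "j \<le> CARD('d)" for j
    using alternating_dependencesD[OF p k b(1) that] .
  \<comment> \<open>If \<open>b 0\<close> were zero, the sign rule would make every
    \<open>b j\<close> zero. Its being non-zero makes all weights strictly positive, as the relative
    interior demands.\<close>
  have b0: "b 0 \<noteq> 0"
    using b(2) sgn_b by (metis mult_zero_right sgn_0 sgn_0_0)
  have bpos: "0 < \<bar>b j\<bar>" if "j \<in> ?D" for j
    using sgn_b[of j] b0 that by (auto simp: sgn_0_0)
  define B where "B = (\<Sum>j\<in>?D. \<bar>b j\<bar>)"
  have B: "0 < B"
    unfolding B_def by (intro sum_pos bpos) auto
  define u where "u j = \<bar>b j\<bar> / B" for j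
  \<comment> \<open>The signed weights are one constant multiple of \<open>b\<close>, so the
    dependence of the \<open>p (k j)\<close> carries over.\<close>
  have "u j * (\<epsilon> * (- 1) ^ j) = (\<epsilon> * sgn (b 0) / B) * b j" if "j \<in> ?D" for j
  proof -
    have "\<bar>b j\<bar> * (- 1) ^ j = b j * (((- 1) ^ j * (- 1) ^ j) * sgn (b 0))"
      using sgn_b[of j] that by (simp add: abs_sgn mult_ac)
    also have "(- 1) ^ j * (- 1) ^ j = (1 :: real)"
      by (simp flip: power_mult_distrib)
    finally show ?thesis
      by (simp add: u_def mult_ac)
  qed
  then have "(\<Sum>j\<in>?D. u j *\<^sub>R e j) = (\<Sum>j\<in>?D. (\<epsilon> * sgn (b 0) / B) *\<^sub>R (b j *\<^sub>R p (k j)))"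
    by (intro sum.cong) (auto simp: e_def)
  also have "\<dots> = 0"
    using b(1) by (simp only: scaleR_right.sum[symmetric]) simp
  finally have "(\<Sum>j\<in>?D. u j *\<^sub>R e j) = 0" .
  moreover have "\<forall>j\<in>?D. 0 < u j"
    using bpos B by (simp add: u_def)
  moreover have "sum u ?D = 1"
    using B by (simp add: u_def B_def flip: sum_divide_distrib)
  ultimately show "0 \<in> rel_interior (convex hull (alternating_vertices p \<epsilon> k))"
    unfolding S using zero_in_rel_interior_convex_hull_image_iff indep inj
    by (metis S)
qed

section \<open>Classification of the origin simplices\<close>

text \<open>Without antipodal pairs, each index occurs with one sign, and positive weights for the
  origin become a dependence of the \<open>p i\<close> carrying these signs. Linear independence of
  up to d vectors and affine independence of \<open>S\<close> leave exactly d + 1 vertices, whose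
  signs must alternate.\<close>

lemma origin_simplex_without_antipodes:
  fixes p :: "nat \<Rightarrow> real^'d"
  assumes p: "alternating_dependences p" and d: "CARD('d) \<ge> 2"
    and S: "S \<in> origin_simplices (p ` A \<union> (\<lambda>i. - p i) ` A)"
    and anti: "\<And>x. x \<in> S \<Longrightarrow> - x \<notin> S"
  obtains \<epsilon> k where "\<epsilon> \<in> {1, - 1}" "strict_mono_on {0..CARD('d)} k" "k ` {0..CARD('d)} \<subseteq> A"
    "S = alternating_vertices p \<epsilon> k"
proof -
  have sub: "S \<subseteq> p ` A \<union> (\<lambda>i. - p i) ` A" and indep: "\<not> affine_dependent S"
    and zero: "0 \<in> rel_interior (convex hull S)"
    using S by (auto simp: origin_simplices_def)
  define I where "I = {i \<in> A. p i \<in> S \<or> - p i \<in> S}"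
  \<comment> \<open>On \<open>I\<close> this is the sign with which \<open>p i\<close> occurs in
    \<open>S\<close>, unique by \<open>anti\<close>; elsewhere it is just some sign.\<close>
  define s :: "nat \<Rightarrow> real" where "s i = (if p i \<in> S then 1 else - 1)" for i
  define e where "e i = s i *\<^sub>R p i" for i
  have S_eq: "S = e ` I"
  proof
    show "S \<subseteq> e ` I"
    proof
      fix x assume x: "x \<in> S"
      then consider i where "i \<in> A" "x = p i" | i where "i \<in> A" "x = - p i"
        using sub by blast
      then show "x \<in> e ` I"
        using x anti[OF x] by cases (auto simp: I_def e_def s_def intro!: image_eqI)
    qed
    show "e ` I \<subseteq> S"
      by (auto simp: I_def e_def s_def)
  qed
  have s: "s i \<in> {1, - 1}" for i
    by (simp add: s_def)
  then have s0: "s i \<noteq> 0" for i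
    by (metis insertE neg_equal_0_iff_equal singletonD zero_neq_one)
  have inj: "inj_on e I"
    using alternating_dependences_distinct[OF p d] s0 by (metis e_def inj_onI)
  have fin: "finite I"
    using inj indep aff_independent_finite S_eq finite_image_iff by blast
  obtain u where u: "\<forall>i\<in>I. 0 < u i" "sum u I = 1" "(\<Sum>i\<in>I. u i *\<^sub>R e i) = 0"
    using zero indep zero_in_rel_interior_convex_hull_image_iff[OF _ inj] unfolding S_eq by blast
  then have rel: "(\<Sum>i\<in>I. (u i * s i) *\<^sub>R p i) = 0"
    by (simp add: e_def)
  have "I \<noteq> {}" using u by auto
  then obtain i where "i \<in> I" by blast
  then have "u i * s i \<noteq> 0" using u s0 by fastforce
  then have "\<not> card I \<le> CARD('d)"
    using alternating_dependences_independent[OF p fin _ rel \<open>i \<in> I\<close>] by blast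
  moreover have "\<not> CARD('d) + 2 \<le> card I"
    using affine_dependent_biggerset[of S] indep fin inj by (auto simp: S_eq card_image)
  ultimately have "card I = Suc (CARD('d))" by simp
  then obtain h where h: "strict_mono_on {0..CARD('d)} h" "bij_betw h {0..CARD('d)} I"
    using obtain_strict_mono_enumeration fin by blast
  have img: "h ` {0..CARD('d)} = I"
    using h(2) by (simp add: bij_betw_def)
  have "(\<Sum>j=0..CARD('d). (u (h j) * s (h j)) *\<^sub>R p (h j)) = 0"
    using sum.reindex_bij_betw[OF h(2), of "\<lambda>i. (u i * s i) *\<^sub>R p i"] rel by simp
  then have *: "sgn (u (h j) * s (h j)) = (- 1) ^ j * sgn (u (h 0) * s (h 0))"
    if "j \<le> CARD('d)" for j
    using alternating_dependencesD[OF p h(1), of "\<lambda>j. u (h j) * s (h j)"] that by blast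
  have **: "sgn (u (h j) * s (h j)) = s (h j)" if "j \<le> CARD('d)" for j
  proof -
    have "0 < u (h j)" using u img that by fastforce
    moreover have "sgn (s (h j)) = s (h j)" by (simp add: s_def)
    ultimately show ?thesis by (simp add: sgn_mult)
  qed
  \<comment> \<open>Positive weights do not change signs, so the vertex signs themselves alternate;
    the sign at the smallest index serves as \<open>\<epsilon>\<close>.\<close>
  have "e (h j) = (s (h 0) * (- 1) ^ j) *\<^sub>R p (h j)" if "j \<in> {0..CARD('d)}" for j
    using *[of j] **[of j] **[of 0] that by (simp add: e_def)
  then have "e ` h ` {0..CARD('d)} = alternating_vertices p (s (h 0)) h"
    unfolding alternating_vertices_def image_image by (rule image_cong[OF refl])
  moreover have "I \<subseteq> A" by (auto simp: I_def)
  ultimately show thesis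
    using that[OF s h(1)] img S_eq by simp
qed

text \<open>An antipodal pair in \<open>S\<close> already exhausts \<open>S\<close>; otherwise the
  preceding classification applies.\<close>

lemma origin_simplices_alternating_dependences:
  fixes p :: "nat \<Rightarrow> real^'d"
  assumes p: "alternating_dependences p" and d: "CARD('d) \<ge> 2"
    and nz: "\<And>i. p i \<noteq> 0"
  shows "origin_simplices (p ` A \<union> (\<lambda>i. - p i) ` A) =
          {{p i, - p i} | i. i \<in> A} \<union>
          {alternating_vertices p \<epsilon> k | \<epsilon> k.
             \<epsilon> \<in> {1, - 1} \<and> strict_mono_on {0..CARD('d)} k \<and> k ` {0..CARD('d)} \<subseteq> A}"
    (is "?L = ?E \<union> ?T")
proof
  show "?L \<subseteq> ?E \<union> ?T"
  proof
    fix S assume S: "S \<in> ?L"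
    show "S \<in> ?E \<union> ?T"
    proof (cases "\<exists>x\<in>S. - x \<in> S")
      case True
      then obtain x where x: "x \<in> S" "- x \<in> S" by blast
      obtain i where i: "i \<in> A" "x = p i \<or> x = - p i"
        using S x by (auto simp: origin_simplices_def)
      then have "x \<noteq> 0" using nz by auto
      then have "S = {x, - x}"
        using S x antipodal_simplex_eq by (auto simp: origin_simplices_def)
      then have "S = {p i, - p i}" using i by auto
      then show ?thesis using i by blast
    next
      case False
      then obtain \<epsilon> k where "\<epsilon> \<in> {1, - 1}" "strict_mono_on {0..CARD('d)} k"
          "k ` {0..CARD('d)} \<subseteq> A" "S = alternating_vertices p \<epsilon> k"
        using origin_simplex_without_antipodes[OF p d S] by metis
      then show ?thesis by blast
    qed
  qed
  have "{p i, - p i} \<in> ?L" if "i \<in> A" for i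
    using that nz zero_in_rel_interior_convex_hull_antipodal[of "p i"]
    by (auto simp: origin_simplices_def)
  moreover have "alternating_vertices p \<epsilon> k \<in> ?L"
    if "\<epsilon> \<in> {1, - 1}" "strict_mono_on {0..CARD('d)} k" "k ` {0..CARD('d)} \<subseteq> A" for \<epsilon> k
  proof -
    have "(\<epsilon> * (- 1) ^ j) *\<^sub>R p (k j) \<in> p ` A \<union> (\<lambda>i. - p i) ` A" if "j \<in> {0..CARD('d)}" for j
    proof -
      have "k j \<in> A" using \<open>k ` {0..CARD('d)} \<subseteq> A\<close> that by blast
      moreover have "\<epsilon> * (- 1) ^ j = 1 \<or> \<epsilon> * (- 1) ^ j = - 1"
        using \<open>\<epsilon> \<in> {1, - 1}\<close> by (cases "even j") auto
      ultimately show ?thesis by auto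
    qed
    then have "alternating_vertices p \<epsilon> k \<subseteq> p ` A \<union> (\<lambda>i. - p i) ` A"
      unfolding alternating_vertices_def by blast
    then show ?thesis
      using alternating_vertices_origin_simplex[OF p d that(2,1)]
      by (simp add: origin_simplices_def)
  qed
  ultimately show "?E \<union> ?T \<subseteq> ?L" by blast
qed

section \<open>Construction of the polytope\<close>

theorem theorem5p2:
  fixes n :: nat
  assumes "CARD('d::finite) \<ge> 2"
    and "n \<ge> CARD('d)"
  shows "\<exists>P :: (real^'d) set. ACS_polytope n P"
proof -
  obtain p :: "nat \<Rightarrow> real^'d" where p: "alternating_dependences p" and norm: "\<And>i. norm (p i) = 1"
    using exists_unit_alternating_dependences by blast
  have nz: "p i \<noteq> 0" for i
    using norm[of i] by auto
  define V where "V = p ` {1..n} \<union> (\<lambda>i. - p i) ` {1..n}"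
  have ext: "{v. v extreme_point_of convex hull V} = V"
    using norm by (intro extreme_points_convex_hull_unit_vectors) (auto simp: V_def)
  have "inj p"
    using alternating_dependences_distinct[OF p assms(1), of _ _ 1 1]
    by (intro injI) (metis zero_neq_one)
  then have "card (p ` {1..n}) = n" "card ((\<lambda>i. - p i) ` {1..n}) = n"
    by (simp_all add: card_image inj_on_def)
  \<comment> \<open>For different indices this is independence of pairs, for equal ones it is
    \<open>p i\<close> being non-zero. The two halves of \<open>V\<close> are thus disjoint, giving
    2n vertices.\<close>
  moreover have "p i \<noteq> - p j" for i j
    using alternating_dependences_distinct[OF p assms(1), of i j 1 "- 1"] nz[of i]
      neq_minus_self[of "p i"]
    by (cases "i = j") auto
  then have "p ` {1..n} \<inter> (\<lambda>i. - p i) ` {1..n} = {}"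
    by auto
  ultimately have "card V = 2 * n"
    by (simp add: V_def card_Un_disjoint)
  then have "ACS_polytope n (convex hull V)"
    unfolding ACS_polytope_def ext
    using origin_simplices_alternating_dependences[OF p assms(1) nz, of "{1..n}"]
    by (intro conjI exI[of _ p] polytope_convex_hull) (simp_all add: V_def)
  then show ?thesis by blast
qed

end
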